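(* Let $E$ be a Riesz space, let $m$ be a positive integer, and let $P\colon E\to\mathbb{R}$ be an $m$-homogeneous polynomial. Then $P$ is orthogonally additive if and only if $$P(x)=P(x^+)+(-1)^mP(x^-)$$ for every $x\in E$.
   Context: An $m$-homogeneous polynomial $P\colon E\to\mathbb{R}$ is a map of the form $P(x)=A(x,\dots,x)$, where $A\colon E^m\to\mathbb{R}$ is a (unique) symmetric $m$-linear map. $P$ is orthogonally additive if $P(x+y)=P(x)+P(y)$ whenever $x,y\in E$ are disjoint, i.e. $|x|\wedge|y|=0$. Here $x^+=x\vee0$ and $x^-=(-x)\vee0$. *)

theory Defs
  imports Complex_Main "HOL-Library.Lattice_Algebras" "HOL-Combinatorics.Permutations"
begin

text \<open>
  In \<^class>\<open>lattice_ab_group_add_abs\<close> the absolute value is the lattice one,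
  \<open>\<bar>x\<bar> = sup x (- x)\<close>, and \<^class>\<open>ordered_real_vector\<close> makes the order compatible with
  multiplication by nonnegative scalars.
\<close>

class riesz_space = ordered_real_vector + lattice_ab_group_add_abs

instance real :: riesz_space
  by standard (auto simp: sup_real_def)

definition disjoint_elems :: "'a::riesz_space \<Rightarrow> 'a \<Rightarrow> bool" where
  "disjoint_elems x y \<longleftrightarrow> inf \<bar>x\<bar> \<bar>y\<bar> = 0"

text \<open>
  Elements of the power \<open>E\<^sup>m\<close> are lists of length \<open>m\<close>; the values of \<open>A\<close> on lists of other
  lengths are irrelevant.
\<close>

definition multilinear_map :: "nat \<Rightarrow> ('a::real_vector list \<Rightarrow> real) \<Rightarrow> bool" where
  "multilinear_map m A \<longleftrightarrow>
     (\<forall>xs i. length xs = m \<longrightarrow> i < m \<longrightarrow> linear (\<lambda>t. A (xs[i := t])))"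

definition symmetric_map :: "nat \<Rightarrow> ('a list \<Rightarrow> real) \<Rightarrow> bool" where
  "symmetric_map m A \<longleftrightarrow>
     (\<forall>xs \<pi>. length xs = m \<longrightarrow> \<pi> permutes {..<m} \<longrightarrow> A (permute_list \<pi> xs) = A xs)"

definition homogeneous_polynomial :: "nat \<Rightarrow> ('a::real_vector \<Rightarrow> real) \<Rightarrow> bool" where
  "homogeneous_polynomial m P \<longleftrightarrow>
     (\<exists>A. multilinear_map m A \<and> symmetric_map m A \<and> (\<forall>x. P x = A (replicate m x)))"

definition orthogonally_additive :: "('a::riesz_space \<Rightarrow> real) \<Rightarrow> bool" where
  "orthogonally_additive P \<longleftrightarrow> (\<forall>x y. disjoint_elems x y \<longrightarrow> P (x + y) = P x + P y)"

end

theory Submission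
  imports Defs "HOL-Computational_Algebra.Polynomial"
begin

text \<open>
  For disjoint \<open>u, v \<ge> 0\<close> and \<open>t \<le> 0\<close> the elements \<open>u\<close> and \<open>- t v\<close> are the positive and negative
  parts of \<open>u + t v\<close>, so the identity gives \<open>P (u + t v) = P u + t\<^sup>m P v\<close> for all \<open>t \<le> 0\<close>. Both
  sides are polynomials in \<open>t\<close>, so this holds for \<open>t = 1\<close> too: \<open>P\<close> is additive on disjoint
  positive elements. For arbitrary disjoint \<open>x, y\<close> one splits \<open>x + y\<close> into
  \<open>x\<^sup>+ + y\<^sup>+\<close> and \<open>x\<^sup>- + y\<^sup>-\<close>.
\<close>

section \<open>Restriction of a homogeneous polynomial to a line\<close>

lemma multilinear_map_linear_append:
  assumes "multilinear_map m A" "Suc (length xs + length ys) = m"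
  shows "linear (\<lambda>t. A (xs @ t # ys))"
proof -
  have "linear (\<lambda>t. A ((xs @ 0 # ys)[length xs := t]))"
    using assms unfolding multilinear_map_def by (elim allE[of _ "xs @ 0 # ys"] allE[of _ "length xs"]) auto
  then show ?thesis by simp
qed

text \<open>Linearity in the last copy of \<open>u + t *\<^sub>R v\<close> leaves \<open>u\<close>
  or \<open>v\<close> in that slot, with coefficient 1 or \<open>t\<close>. The arbitrary tail
  \<open>xs\<close> absorbs that vector, so that the induction on \<open>k\<close> applies to both
  terms.\<close>

lemma multilinear_map_poly:
  assumes "multilinear_map m A" "k + length xs = m"
  shows "\<exists>p. \<forall>t. A (replicate k (u + t *\<^sub>R v) @ xs) = poly p t"
  using assms(2)
proof (induction k arbitrary: xs)
  case 0
  show ?case by (rule exI[of _ "[:A xs:]"]) simp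
next
  case (Suc k)
  obtain p where p: "\<And>t. A (replicate k (u + t *\<^sub>R v) @ u # xs) = poly p t"
    using Suc.IH[of "u # xs"] Suc.prems by auto
  obtain q where q: "\<And>t. A (replicate k (u + t *\<^sub>R v) @ v # xs) = poly q t"
    using Suc.IH[of "v # xs"] Suc.prems by auto
  have "A (replicate (Suc k) (u + t *\<^sub>R v) @ xs) = poly (p + pCons 0 q) t" for t
  proof -
    let ?ws = "replicate k (u + t *\<^sub>R v)"
    have lin: "linear (\<lambda>w. A (?ws @ w # xs))"
      using Suc.prems by (intro multilinear_map_linear_append[OF assms(1)]) simp
    have "A (replicate (Suc k) (u + t *\<^sub>R v) @ xs) = A (?ws @ (u + t *\<^sub>R v) # xs)"
      by (metis append_Cons append_assoc append_Nil replicate_Suc replicate_append_same)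
    also have "\<dots> = A (?ws @ u # xs) + t * A (?ws @ v # xs)"
      using linear_add[OF lin] linear_scale[OF lin] by simp
    finally show ?thesis by (simp add: p q)
  qed
  then show ?case by blast
qed

text \<open>Same induction: each slot moved into the tail releases one factor
  \<open>c\<close>.\<close>

lemma multilinear_map_scale:
  assumes "multilinear_map m A" "k + length xs = m"
  shows "A (replicate k (c *\<^sub>R x) @ xs) = c ^ k * A (replicate k x @ xs)"
  using assms(2)
proof (induction k arbitrary: xs)
  case 0
  show ?case by simp
next
  case (Suc k)
  let ?ws = "replicate k (c *\<^sub>R x)"
  have lin: "linear (\<lambda>w. A (?ws @ w # xs))"
    using Suc.prems by (intro multilinear_map_linear_append[OF assms(1)]) simp
  have "A (replicate (Suc k) (c *\<^sub>R x) @ xs) = A (?ws @ (c *\<^sub>R x) # xs)"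
    by (metis append_Cons append_assoc append_Nil replicate_Suc replicate_append_same)
  also have "\<dots> = c * (c ^ k * A (replicate k x @ x # xs))"
    using linear_scale[OF lin] Suc.IH[of "x # xs"] Suc.prems by simp
  also have "replicate k x @ x # xs = replicate (Suc k) x @ xs"
    by (metis append_Cons append_assoc append_Nil replicate_Suc replicate_append_same)
  finally show ?case by simp
qed

lemma homogeneous_polynomial_poly:
  assumes "homogeneous_polynomial m P"
  obtains p where "\<And>t. P (u + t *\<^sub>R v) = poly p t"
proof -
  obtain A where "multilinear_map m A" and P: "\<And>x. P x = A (replicate m x)"
    using assms unfolding homogeneous_polynomial_def by blast
  then show thesis
    using multilinear_map_poly[of m A m "[]" u v] that by auto
qed

lemma homogeneous_polynomial_scale:
  assumes "homogeneous_polynomial m P"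
  shows "P (c *\<^sub>R x) = c ^ m * P x"
proof -
  obtain A where "multilinear_map m A" and "\<And>x. P x = A (replicate m x)"
    using assms unfolding homogeneous_polynomial_def by blast
  then show ?thesis
    using multilinear_map_scale[of m A m "[]" c x] by simp
qed

lemma homogeneous_polynomial_minus:
  assumes "homogeneous_polynomial m P"
  shows "P (- x) = (-1) ^ m * P x"
  using homogeneous_polynomial_scale[OF assms, of "-1" x] by simp

text \<open>A nonzero \<open>p - q\<close> would have finitely many roots, but it vanishes on a
  half-line.\<close>

lemma poly_eq_of_nonpos:
  fixes p q :: "real poly"
  assumes "\<And>t. t \<le> 0 \<Longrightarrow> poly p t = poly q t"
  shows "p = q"
proof (rule ccontr)
  assume "p \<noteq> q"
  then have "finite {t. poly (p - q) t = 0}"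
    by (intro poly_roots_finite) simp
  moreover have "{..0} \<subseteq> {t. poly (p - q) t = 0}"
    using assms by auto
  ultimately show False
    using finite_subset infinite_Iic by blast
qed

section \<open>Positive parts, negative parts and disjointness\<close>

text \<open>Translation by \<open>v\<close> turns the left side into \<open>sup u v - v\<close>, and
  \<open>u + v = inf u v + sup u v\<close> gives \<open>sup u v = u + v\<close>.\<close>

lemma pos_part_diff:
  fixes u v :: "'a::lattice_ab_group_add"
  assumes "inf u v = 0"
  shows "sup (u - v) 0 = u"
proof -
  have "sup (u - v) 0 = sup u v - v"
    by (simp only: diff_conv_add_uminus add_sup_distrib_right right_minus)
  also have "\<dots> = u"
    using add_eq_inf_sup[of u v] assms by (simp add: diff_eq_eq)
  finally show ?thesis .
qed

lemma neg_part_diff: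
  fixes u v :: "'a::lattice_ab_group_add"
  assumes "inf u v = 0"
  shows "sup (- (u - v)) 0 = v"
  using pos_part_diff[of v u] assms by (simp add: inf.commute)

lemma pos_part_minus_neg_part:
  fixes x :: "'a::lattice_ab_group_add"
  shows "sup x 0 - sup (- x) 0 = x"
proof -
  have "- sup (- x) 0 = inf x 0"
    by (simp add: neg_sup_eq_inf)
  then show ?thesis
    by (simp only: diff_conv_add_uminus prts[of x, unfolded pprt_def nprt_def, symmetric])
qed

text \<open>Both arguments are translates by the negative part, of \<open>x\<close> and of
  \<open>0\<close>; the infimum is therefore \<open>inf x 0\<close> plus the negative part, and
  these two cancel.\<close>

lemma inf_pos_part_neg_part:
  fixes x :: "'a::lattice_ab_group_add"
  shows "inf (sup x 0) (sup (- x) 0) = 0"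
proof -
  let ?n = "sup (- x) 0"
  have "inf (sup x 0) ?n = inf (x + ?n) (0 + ?n)"
    using pos_part_minus_neg_part[of x] by (simp only: diff_eq_eq add_0_left)
  also have "\<dots> = inf x 0 + ?n"
    by (simp only: add_inf_distrib_right)
  also have "\<dots> = 0"
    using neg_inf_eq_sup[of x 0] by (metis add.right_inverse minus_zero)
  finally show ?thesis .
qed

lemma inf_add_eq_0:
  fixes a b c :: "'a::lattice_ab_group_add"
  assumes "inf a c = 0" "inf b c = 0"
  shows "inf (a + b) c = 0"
proof (rule antisym)
  let ?w = "inf (a + b) c"
  have nonneg: "0 \<le> a" "0 \<le> b" "0 \<le> c"
    using assms by (metis inf.cobounded1 inf.cobounded2)+
  \<comment> \<open>Subtracting \<open>b\<close> brings \<open>?w\<close> below both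
    \<open>a\<close> and \<open>c\<close>, hence below \<open>inf a c = 0\<close>; then
    \<open>?w\<close> lies below both \<open>b\<close> and \<open>c\<close>.\<close>
  have "?w - b \<le> a"
    by (simp add: diff_le_eq)
  moreover have "?w - b \<le> c"
    using nonneg(2) inf.cobounded2[of "a + b" c] by (simp add: diff_le_eq add_increasing2)
  ultimately have "?w \<le> b"
    using assms(1) by (metis diff_le_0_iff_le le_inf_iff)
  then show "?w \<le> 0"
    using assms(2) by (metis inf.cobounded2 le_inf_iff)
  show "0 \<le> ?w"
    using nonneg by simp
qed

lemma inf_scaleR_eq_0:
  fixes u v :: "'a::riesz_space"
  assumes "inf u v = 0" "0 \<le> c"
  shows "inf u (c *\<^sub>R v) = 0"
proof (rule antisym)
  \<comment> \<open>\<open>?d\<close> dominates both coefficients, 1 of \<open>u\<close> and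
    \<open>c\<close> of \<open>v\<close>, and is positive even for \<open>c = 0\<close>, so dividing
    by it is allowed.\<close>
  let ?w = "inf u (c *\<^sub>R v)" and ?d = "max 1 c"
  have nonneg: "0 \<le> u" "0 \<le> v"
    using assms(1) by (metis inf.cobounded1 inf.cobounded2)+
  have d: "0 < ?d" by simp
  have "u \<le> ?d *\<^sub>R u" "c *\<^sub>R v \<le> ?d *\<^sub>R v"
    using scaleR_right_mono[of 1 ?d u] scaleR_right_mono[of c ?d v] nonneg by simp_all
  then have "?w \<le> ?d *\<^sub>R u" "?w \<le> ?d *\<^sub>R v"
    by (meson inf.cobounded1 inf.cobounded2 order_trans)+
  then have "?w /\<^sub>R ?d \<le> inf u v"
    using d by (simp only: pos_divideR_le_eq le_inf_iff)
  then show "?w \<le> 0"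
    using d assms(1) by (metis pos_divideR_le_eq scaleR_zero_right)
  show "0 \<le> ?w"
    using nonneg assms(2) by (simp add: scaleR_nonneg_nonneg)
qed

lemma inf_eq_0_mono:
  fixes a b c d :: "'a::lattice_ab_group_add"
  assumes "inf c d = 0" "0 \<le> a" "a \<le> c" "0 \<le> b" "b \<le> d"
  shows "inf a b = 0"
proof (rule antisym)
  show "inf a b \<le> 0"
    using inf_mono[OF assms(3,5)] by (simp only: assms(1))
  show "0 \<le> inf a b"
    using assms(2,4) by (rule inf_greatest)
qed

lemma disjoint_elems_parts:
  fixes x y :: "'a::riesz_space"
  assumes "disjoint_elems x y" "a \<in> {sup x 0, sup (- x) 0}" "b \<in> {sup y 0, sup (- y) 0}"
  shows "inf a b = 0"
proof -
  have "sup z 0 \<le> \<bar>z\<bar>" "sup (- z) 0 \<le> \<bar>z\<bar>" for z :: 'a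
    by (simp_all add: abs_ge_self abs_ge_minus_self)
  then have "0 \<le> a" "a \<le> \<bar>x\<bar>" "0 \<le> b" "b \<le> \<bar>y\<bar>"
    using assms(2,3) by fastforce+
  then show ?thesis
    using assms(1) unfolding disjoint_elems_def by (metis inf_eq_0_mono)
qed

text \<open>Makes orthogonal additivity applicable to x as the sum of its positive part and minus
  its negative part.\<close>

lemma disjoint_elems_pos_neg:
  fixes u v :: "'a::riesz_space"
  assumes "inf u v = 0"
  shows "disjoint_elems u (- v)"
proof -
  have "0 \<le> u" "0 \<le> v"
    using assms by (metis inf.cobounded1 inf.cobounded2)+
  then show ?thesis
    using assms by (simp add: disjoint_elems_def)
qed

lemma additive_on_disjoint_nonneg:
  fixes P :: "'a::riesz_space \<Rightarrow> real"
  assumes P: "homogeneous_polynomial m P"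
    and split: "\<And>x. P x = P (sup x 0) + (-1) ^ m * P (sup (- x) 0)"
    and uv: "inf u v = 0"
  shows "P (u + v) = P u + P v"
proof -
  obtain p where p: "\<And>t. P (u + t *\<^sub>R v) = poly p t"
    using homogeneous_polynomial_poly[OF P] by blast
  have "p = [:P u:] + monom (P v) m"
  proof (rule poly_eq_of_nonpos)
    fix t :: real
    assume "t \<le> 0"
    then have inf: "inf u ((- t) *\<^sub>R v) = 0"
      by (intro inf_scaleR_eq_0[OF uv]) simp
    \<comment> \<open>Written as this difference, \<open>u + t *\<^sub>R v\<close> has the parts
      \<open>u\<close> and \<open>(- t) *\<^sub>R v\<close>.\<close>
    have "P (u - (- t) *\<^sub>R v) = P u + (-1) ^ m * P ((- t) *\<^sub>R v)"
      using split[of "u - (- t) *\<^sub>R v"]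
      unfolding pos_part_diff[OF inf] neg_part_diff[OF inf] .
    \<comment> \<open>The sign \<open>(-1) ^ m\<close> cancels against that of
      \<open>(- t) ^ m\<close>.\<close>
    also have "\<dots> = P u + t ^ m * P v"
      unfolding homogeneous_polynomial_scale[OF P]
      by (simp flip: power_mult_distrib mult.assoc)
    finally show "poly p t = poly ([:P u:] + monom (P v) m) t"
      by (simp add: p poly_monom mult.commute)
  qed
  then show ?thesis
    using p[of 1] by (simp add: poly_monom)
qed

theorem lemma2:
  fixes P :: "'a::riesz_space \<Rightarrow> real" and m :: nat
  assumes "m > 0"
    and "homogeneous_polynomial m P"
  shows "orthogonally_additive P \<longleftrightarrow>
    (\<forall>x. P x = P (sup x 0) + (-1) ^ m * P (sup (- x) 0))"
proof
  assume "orthogonally_additive P"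
  then have "P (sup x 0 + - sup (- x) 0) = P (sup x 0) + P (- sup (- x) 0)" for x
    using disjoint_elems_pos_neg[OF inf_pos_part_neg_part] unfolding orthogonally_additive_def
    by blast
  moreover have "sup x 0 + - sup (- x) 0 = x" for x :: 'a
    using pos_part_minus_neg_part[of x] by (simp only: diff_conv_add_uminus)
  ultimately show "\<forall>x. P x = P (sup x 0) + (-1) ^ m * P (sup (- x) 0)"
    by (metis homogeneous_polynomial_minus[OF assms(2)])
next
  assume split: "\<forall>x. P x = P (sup x 0) + (-1) ^ m * P (sup (- x) 0)"
  note add = additive_on_disjoint_nonneg[OF assms(2) split[rule_format]]
  show "orthogonally_additive P"
    unfolding orthogonally_additive_def
  proof (intro allI impI)
    fix x y :: 'a
    assume xy: "disjoint_elems x y"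
    let ?xp = "sup x 0" and ?xn = "sup (- x) 0" and ?yp = "sup y 0" and ?yn = "sup (- y) 0"
    have cross: "inf ?xp ?yp = 0" "inf ?xp ?yn = 0" "inf ?xn ?yp = 0" "inf ?xn ?yn = 0"
      by (rule disjoint_elems_parts[OF xy]; simp)+
    have "inf (?xp + ?yp) ?xn = 0" "inf (?xp + ?yp) ?yn = 0"
      using cross inf_pos_part_neg_part[of x] inf_pos_part_neg_part[of y]
      by (metis inf_add_eq_0 inf.commute)+
    then have inf: "inf (?xp + ?yp) (?xn + ?yn) = 0"
      using inf_add_eq_0[of ?xn "?xp + ?yp" ?yn] by (metis inf.commute)
    \<comment> \<open>By \<open>inf\<close>, the two brackets are the positive and the negative part
      of \<open>x + y\<close>.\<close>
    have sum: "x + y = (?xp + ?yp) - (?xn + ?yn)"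
      using add_diff_add[of ?xp ?yp ?xn ?yn] by (simp only: pos_part_minus_neg_part)
    have "P (x + y) = P (?xp + ?yp) + (-1) ^ m * P (?xn + ?yn)"
      using split[rule_format, of "x + y"]
      unfolding sum pos_part_diff[OF inf] neg_part_diff[OF inf] .
    \<comment> \<open>Each bracket is a sum of disjoint positive elements, so \<open>P\<close>
      splits on it; regrouping collects the parts of \<open>x\<close> and those of
      \<open>y\<close>.\<close>
    also have "\<dots> = (P ?xp + (-1) ^ m * P ?xn) + (P ?yp + (-1) ^ m * P ?yn)"
      using add[OF cross(1)] add[OF cross(4)] by (simp add: algebra_simps)
    also have "\<dots> = P x + P y"
      by (rule arg_cong2[of _ _ _ _ "(+)", OF split[rule_format, of x, symmetric]
            split[rule_format, of y, symmetric]])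
    finally show "P (x + y) = P x + P y" .
  qed
qed

end
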